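(* If $\Gamma \models \mathbb{M}:\tau$ and $\mathbb{M} \longrightarrow \mathbb{M}'$ then $\Gamma \models \mathbb{M}' :\tau$.
   Context: $\lambda^{\text{↯}}_{\oplus}$: resource $\lambda$-calculus with terms $M ::= x \mid \lambda x.M \mid M\,B \mid M\langle B/x\rangle \mid \mathtt{fail}^{\widetilde{x}}$, bags (multisets of terms), expressions = sums. Reduction: $\beta$ to explicit substitution; fetch (if $\mathrm{head}(M)=x$ and $\#(x,M)=|B|=k\ge1$, $M\langle B/x\rangle$ reduces to the sum of linear head substitutions of each $N_i\in B$ with the rest of the bag kept in the substitution); fail (if $\#(x,M)\ne|B|$, $M\langle B/x\rangle\longrightarrow\sum_{\mathrm{PER}(B)}\mathtt{fail}^{\widetilde{y}}$ collecting free variables); consumption rules $\mathtt{fail}^{\widetilde{x}}B\longrightarrow\sum\mathtt{fail}^{\widetilde{x}\uplus\mathrm{mfv}(B)}$ and $\mathtt{fail}^{\widetilde{x}}\langle B/z\rangle\longrightarrow\sum\mathtt{fail}^{(\widetilde{x}\setminus z)\uplus\mathrm{mfv}(B)}$ (when $\#(z,\widetilde{x})+|B|\ne0$); closure under term and sum contexts. $\models$ is well-formedness: well-typed expressions (non-idempotent intersection types, exact resource matching) are well-formed; well-formedness allows mismatches between bag sizes and expected multiplicities in application and explicit substitution, and types $\mathtt{fail}^{\widetilde{x}}$ with any $\tau$ when $\mathrm{dom}(\Gamma)=\widetilde{x}$. *)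

theory Defs
  imports "HOL-Library.Multiset" "HOL-Combinatorics.Permutations"
begin

section \<open>Syntax\<close>

text \<open>
  Terms are taken up to renaming of bound variables, via de Bruijn indices: \<open>Lam M\<close> and
  \<open>ESub M B\<close> (the explicit substitution of \<open>B\<close> for index \<open>0\<close> in \<open>M\<close>) bind index \<open>0\<close> of \<open>M\<close>;
  the bag \<open>B\<close> is outside that scope. Bags are built from the empty bag and singletons by an
  associative and commutative concatenation with unit, i.e. they are finite multisets of terms.
  The indices in \<open>Fail X\<close> are variable occurrences like any other and may be bound from outside.
\<close>

datatype tm =
    Var nat
  | Lam tm
  | App tm "tm multiset"
  | ESub tm "tm multiset"
  | Fail "nat multiset"

type_synonym bag = "tm multiset"

text \<open>
  Expressions are formal sums of terms, up to associativity and commutativity but not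
  idempotence. A sum has at least one summand: the empty multiset is not an expression. It is
  neither well-formed, nor does it reduce or arise by reduction.
\<close>

type_synonym expr = "tm multiset"

text \<open>Leaving the scope of a binder: all occurrences of the bound variable are removed and the
  other indices are renumbered.\<close>

definition unbind :: "nat multiset \<Rightarrow> nat multiset" where
  "unbind X = image_mset (\<lambda>n. n - 1) (filter_mset (\<lambda>n. n \<noteq> 0) X)"

primrec mfv :: "tm \<Rightarrow> nat multiset" where
  "mfv (Var x) = {#x#}"
| "mfv (Lam M) = unbind (mfv M)"
| "mfv (App M B) = mfv M + sum_mset (image_mset mfv B)"
| "mfv (ESub M B) = unbind (mfv M) + sum_mset (image_mset mfv B)"
| "mfv (Fail X) = X"

abbreviation mfv_bag :: "bag \<Rightarrow> nat multiset" where
  "mfv_bag B \<equiv> sum_mset (image_mset mfv B)"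

abbreviation occ :: "nat \<Rightarrow> tm \<Rightarrow> nat" where
  "occ x M \<equiv> count (mfv M) x"

primrec lift_at :: "tm \<Rightarrow> nat \<Rightarrow> tm" where
  "lift_at (Var x) k = Var (if x < k then x else Suc x)"
| "lift_at (Lam M) k = Lam (lift_at M (Suc k))"
| "lift_at (App M B) k = App (lift_at M k) (image_mset (\<lambda>N. lift_at N k) B)"
| "lift_at (ESub M B) k = ESub (lift_at M (Suc k)) (image_mset (\<lambda>N. lift_at N k) B)"
| "lift_at (Fail X) k = Fail (image_mset (\<lambda>x. if x < k then x else Suc x) X)"

abbreviation lift :: "tm \<Rightarrow> tm" where
  "lift N \<equiv> lift_at N 0"


section \<open>Reduction\<close>

text \<open>
  The head of a term, as a pair \<open>(d, H)\<close>: \<open>H\<close> is the head and \<open>d\<close> is the number of explicit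
  substitutions crossed to reach it. Variable \<open>x\<close> of the whole term is thus \<open>Var (d + x)\<close> at
  the head, which distinguishes it from the variables bound on the way.
\<close>

primrec head :: "tm \<Rightarrow> nat \<times> tm" where
  "head (Var x) = (0, Var x)"
| "head (Lam M) = (0, Lam M)"
| "head (App M B) = head M"
| "head (ESub M B) =
     (if occ 0 M = size B then (case head M of (d, H) \<Rightarrow> (Suc d, H)) else (0, Fail {#}))"
| "head (Fail X) = (0, Fail X)"

definition head_var :: "tm \<Rightarrow> nat \<Rightarrow> bool" where
  "head_var M x \<longleftrightarrow> (\<exists>d. head M = (d, Var (d + x)))"

text \<open>
  \<open>lhsubst M N x\<close> is the linear head substitution of \<open>N\<close> for \<open>x\<close> in \<open>M\<close>. It is meaningful
  only if \<open>head_var M x\<close>; the remaining values are irrelevant.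
\<close>

fun lhsubst :: "tm \<Rightarrow> tm \<Rightarrow> nat \<Rightarrow> tm" where
  "lhsubst (Var y) N x = (if y = x then N else Var y)"
| "lhsubst (App M B) N x = App (lhsubst M N x) B"
| "lhsubst (ESub M B) N x = ESub (lhsubst M (lift N) (Suc x)) B"
| "lhsubst (Lam M) N x = Lam M"
| "lhsubst (Fail X) N x = Fail X"

text \<open>
  The sum of copies of \<open>M\<close> over the permutations of the bag \<open>B\<close>. Permutations are those of the
  positions in the bag, so there are \<open>fact (size B)\<close> summands even if elements of \<open>B\<close> coincide,
  just as a fetch has one summand per position.
\<close>

definition sum_PER :: "bag \<Rightarrow> tm \<Rightarrow> expr" where
  "sum_PER B M = image_mset (\<lambda>_. M) (mset_set {p. p permutes {..<size B}})"

text \<open>In a fetch the substituted element enters the scope of the explicit substitution, hence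
  the lifting.\<close>

inductive tred :: "tm \<Rightarrow> expr \<Rightarrow> bool" where
  R_Beta: "tred (App (Lam M) B) {#ESub M B#}"
| R_Fetch: "head_var M 0 \<Longrightarrow> occ 0 M = size B \<Longrightarrow> size B \<ge> 1 \<Longrightarrow>
    tred (ESub M B) (image_mset (\<lambda>N. ESub (lhsubst M (lift N) 0) (B - {#N#})) B)"
| R_Fail: "occ 0 M \<noteq> size B \<Longrightarrow>
    tred (ESub M B) (sum_PER B (Fail (unbind (mfv M) + mfv_bag B)))"
| R_Cons1: "tred (App (Fail X) B) (sum_PER B (Fail (X + mfv_bag B)))"
| R_Cons2: "count X 0 + size B \<noteq> 0 \<Longrightarrow>
    tred (ESub (Fail X) B) (sum_PER B (Fail (unbind X + mfv_bag B)))"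
| R_TCont_App: "tred M E \<Longrightarrow> tred (App M B) (image_mset (\<lambda>M'. App M' B) E)"
| R_TCont_ESub: "tred M E \<Longrightarrow> tred (ESub M B) (image_mset (\<lambda>M'. ESub M' B) E)"

inductive red :: "expr \<Rightarrow> expr \<Rightarrow> bool"  (infix \<open>\<longmapsto>\<close> 50) where
  R_Term: "tred M E \<Longrightarrow> {#M#} \<longmapsto> E"
| R_ECont: "E \<longmapsto> E' \<Longrightarrow> F + E \<longmapsto> F + E'"


section \<open>Types and contexts\<close>

text \<open>
  Multiset types are finite multisets of strict types: intersection is associative,
  commutative and non-idempotent, with the empty type \<open>\<omega>\<close> as its unit.
\<close>

datatype sty = Unit | Arrow "sty multiset" sty

type_synonym mty = "sty multiset"

abbreviation omega :: mty  (\<open>\<omega>\<close>) where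
  "\<omega> \<equiv> {#}"

abbreviation power_ty :: "sty \<Rightarrow> nat \<Rightarrow> mty" where
  "power_ty \<sigma> k \<equiv> replicate_mset k \<sigma>"

text \<open>
  A context maps a variable to the intersection of all the types assigned to it; \<open>Some \<omega>\<close> is an
  explicit assignment of the empty type, as introduced by weakening, and differs from \<open>None\<close>.
  Only contexts with finite domain occur in derivable judgements.
\<close>

type_synonym ctx = "nat \<rightharpoonup> mty"

text \<open>Juxtaposition of contexts, which may share variables.\<close>

definition ctx_conj :: "ctx \<Rightarrow> ctx \<Rightarrow> ctx"  (infixl \<open>\<and>\<^sub>c\<close> 65) where
  "\<Gamma> \<and>\<^sub>c \<Delta> = (\<lambda>x. case (\<Gamma> x, \<Delta> x) of
     (None, d) \<Rightarrow> d
   | (g, None) \<Rightarrow> g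
   | (Some \<pi>, Some \<zeta>) \<Rightarrow> Some (\<pi> + \<zeta>))"

text \<open>Extension by a fresh variable with type \<open>\<pi>\<close>, which becomes index \<open>0\<close>; the freshness
  condition on the variable is thereby automatic.\<close>

definition ctx_ext :: "mty \<Rightarrow> ctx \<Rightarrow> ctx"  (infixr \<open>\<cdot>\<^sub>c\<close> 70) where
  "\<pi> \<cdot>\<^sub>c \<Gamma> = case_nat (Some \<pi>) \<Gamma>"

text \<open>
  The domain as a multiset, to be compared with the multiset decorating a failure: a variable
  of type \<open>\<sigma>\<^sub>1 \<and> \<dots> \<and> \<sigma>\<^sub>k\<close> is declared \<open>k\<close> times, one of type \<open>\<omega>\<close> is not available for use.
\<close>

definition mdom :: "ctx \<Rightarrow> nat multiset" where
  "mdom \<Gamma> = (\<Sum>x\<in>dom \<Gamma>. replicate_mset (size (the (\<Gamma> x))) x)"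


section \<open>Well-typedness\<close>

inductive wt :: "ctx \<Rightarrow> tm \<Rightarrow> sty \<Rightarrow> bool"
  and wt_bag :: "ctx \<Rightarrow> bag \<Rightarrow> mty \<Rightarrow> bool" where
  T_var: "wt [x \<mapsto> {#\<sigma>#}] (Var x) \<sigma>"
| T_weak: "wt \<Gamma> M \<sigma> \<Longrightarrow> x \<notin> dom \<Gamma> \<Longrightarrow> wt (\<Gamma>(x \<mapsto> \<omega>)) M \<sigma>"
| T_abs: "wt (power_ty \<sigma> n \<cdot>\<^sub>c \<Gamma>) M \<tau> \<Longrightarrow> wt \<Gamma> (Lam M) (Arrow (power_ty \<sigma> n) \<tau>)"
| T_app: "wt \<Gamma> M (Arrow \<pi> \<tau>) \<Longrightarrow> wt_bag \<Delta> B \<pi> \<Longrightarrow> wt (\<Gamma> \<and>\<^sub>c \<Delta>) (App M B) \<tau>"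
| T_ex_sub: "wt (power_ty \<sigma> k \<cdot>\<^sub>c \<Gamma>) M \<tau> \<Longrightarrow> wt_bag \<Delta> B (power_ty \<sigma> k) \<Longrightarrow>
    wt (\<Gamma> \<and>\<^sub>c \<Delta>) (ESub M B) \<tau>"
| T_one: "wt_bag Map.empty {#} \<omega>"
| T_bag: "wt \<Gamma> M \<sigma> \<Longrightarrow> wt_bag \<Delta> B (power_ty \<sigma> k) \<Longrightarrow>
    wt_bag (\<Gamma> \<and>\<^sub>c \<Delta>) ({#M#} + B) (power_ty \<sigma> (Suc k))"

inductive wt_expr :: "ctx \<Rightarrow> expr \<Rightarrow> sty \<Rightarrow> bool" where
  T_term: "wt \<Gamma> M \<sigma> \<Longrightarrow> wt_expr \<Gamma> {#M#} \<sigma>"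
| T_sum: "wt_expr \<Gamma> E \<sigma> \<Longrightarrow> wt_expr \<Gamma> F \<sigma> \<Longrightarrow> wt_expr \<Gamma> (E + F) \<sigma>"


section \<open>Well-formedness\<close>

text \<open>In \<open>F_app\<close> and \<open>F_ex_sub\<close> the multiplicities \<open>j\<close> and \<open>k\<close> are independent; only the
  underlying strict type \<open>\<sigma>\<close> has to agree.\<close>

inductive wf_tm :: "ctx \<Rightarrow> tm \<Rightarrow> sty \<Rightarrow> bool"
  and wf_bag :: "ctx \<Rightarrow> bag \<Rightarrow> mty \<Rightarrow> bool" where
  F_wf_tm: "wt \<Gamma> M \<tau> \<Longrightarrow> wf_tm \<Gamma> M \<tau>"
| F_weak: "wf_tm \<Gamma> M \<tau> \<Longrightarrow> x \<notin> dom \<Gamma> \<Longrightarrow> wf_tm (\<Gamma>(x \<mapsto> \<omega>)) M \<tau>"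
| F_abs: "wf_tm (power_ty \<sigma> n \<cdot>\<^sub>c \<Gamma>) M \<tau> \<Longrightarrow> wf_tm \<Gamma> (Lam M) (Arrow (power_ty \<sigma> n) \<tau>)"
| F_app: "wf_tm \<Gamma> M (Arrow (power_ty \<sigma> j) \<tau>) \<Longrightarrow> wf_bag \<Delta> B (power_ty \<sigma> k) \<Longrightarrow>
    wf_tm (\<Gamma> \<and>\<^sub>c \<Delta>) (App M B) \<tau>"
| F_ex_sub: "wf_tm (power_ty \<sigma> k \<cdot>\<^sub>c \<Gamma>) M \<tau> \<Longrightarrow> wf_bag \<Delta> B (power_ty \<sigma> j) \<Longrightarrow>
    wf_tm (\<Gamma> \<and>\<^sub>c \<Delta>) (ESub M B) \<tau>"
| F_fail: "finite (dom \<Gamma>) \<Longrightarrow> mdom \<Gamma> = X \<Longrightarrow> wf_tm \<Gamma> (Fail X) \<tau>"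
| F_wf_bag: "wt_bag \<Gamma> B \<pi> \<Longrightarrow> wf_bag \<Gamma> B \<pi>"
| F_bag: "wf_tm \<Gamma> M \<sigma> \<Longrightarrow> wf_bag \<Delta> B (power_ty \<sigma> k) \<Longrightarrow>
    wf_bag (\<Gamma> \<and>\<^sub>c \<Delta>) ({#M#} + B) (power_ty \<sigma> (Suc k))"

inductive wf_expr :: "ctx \<Rightarrow> expr \<Rightarrow> sty \<Rightarrow> bool"  (\<open>(_/ \<Turnstile> _ :/ _)\<close> [51, 51, 51] 50) where
  F_wf_expr: "wt_expr \<Gamma> E \<tau> \<Longrightarrow> \<Gamma> \<Turnstile> E : \<tau>"
| F_term: "wf_tm \<Gamma> M \<tau> \<Longrightarrow> \<Gamma> \<Turnstile> {#M#} : \<tau>"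
| F_sum: "\<Gamma> \<Turnstile> E : \<tau> \<Longrightarrow> \<Gamma> \<Turnstile> F : \<tau> \<Longrightarrow> \<Gamma> \<Turnstile> E + F : \<tau>"

end

(*
  Assignments x : \<omega> carry no information: a context can be replaced by the total function
  sending each variable to its multiset type, with \<omega> for undeclared variables. On such
  total contexts juxtaposition is pointwise addition, weakening disappears, and the typing rules
  become syntax-directed, so that subject reduction follows by inversion. For failures one uses
  that the sizes of the types in the context are the multiplicities of the free variables, which
  reductions to failure preserve. For fetch one uses that linear head substitution trades one
  occurrence of the type of the head variable for the context of the substituted term.
*)
theory Submission
  imports Defs "HOL-Library.Function_Algebras"
begin

section \<open>Typing in total contexts\<close>

type_synonym tctx = "nat \<Rightarrow> mty"

abbreviation single :: "nat \<Rightarrow> sty \<Rightarrow> tctx" where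
  "single x \<sigma> \<equiv> (\<lambda>y. if y = x then {#\<sigma>#} else {#})"

text \<open>A bag is assigned the common strict type of its elements; the multiplicity is its size.\<close>

inductive tt :: "tctx \<Rightarrow> tm \<Rightarrow> sty \<Rightarrow> bool"
  and tt_bag :: "tctx \<Rightarrow> bag \<Rightarrow> sty \<Rightarrow> bool" where
  tt_Var: "tt (single x \<sigma>) (Var x) \<sigma>"
| tt_Lam: "tt (case_nat (power_ty \<sigma> n) G) M \<tau> \<Longrightarrow> tt G (Lam M) (Arrow (power_ty \<sigma> n) \<tau>)"
| tt_App: "tt G M (Arrow (power_ty \<sigma> j) \<tau>) \<Longrightarrow> tt_bag D B \<sigma> \<Longrightarrow> tt (G + D) (App M B) \<tau>"
| tt_ESub: "tt (case_nat (power_ty \<sigma> k) G) M \<tau> \<Longrightarrow> tt_bag D B \<sigma> \<Longrightarrow> tt (G + D) (ESub M B) \<tau>"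
| tt_Fail: "(\<And>x. size (G x) = count X x) \<Longrightarrow> tt G (Fail X) \<tau>"
| tt_empty: "tt_bag 0 {#} \<sigma>"
| tt_add: "tt G M \<sigma> \<Longrightarrow> tt_bag D B \<sigma> \<Longrightarrow> tt_bag (G + D) (add_mset M B) \<sigma>"

inductive_cases tt_VarE: "tt G (Var x) \<tau>"
inductive_cases tt_LamE: "tt G (Lam M) \<tau>"
inductive_cases tt_AppE: "tt G (App M B) \<tau>"
inductive_cases tt_ESubE: "tt G (ESub M B) \<tau>"

lemma case_nat_plus:
  fixes G D :: tctx
  shows "case_nat \<pi> G + case_nat \<rho> D = case_nat (\<pi> + \<rho>) (G + D)"
  by (auto simp: fun_eq_iff split: nat.split)

lemma count_unbind: "count (unbind X) x = count X (Suc x)"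
proof (induction X)
  case empty
  then show ?case by (simp add: unbind_def)
next
  case (add y X)
  then show ?case by (cases y) (auto simp: unbind_def)
qed

text \<open>The rules for total contexts have no weakening: each variable occurrence brings exactly
  one type, contexts of subterms are added, and \<open>tt_Fail\<close> demands the count
  outright.\<close>

lemma size_tctx:
  "tt G M \<tau> \<Longrightarrow> size (G x) = occ x M"
  "tt_bag D B \<sigma> \<Longrightarrow> size (D x) = count (mfv_bag B) x"
proof (induction arbitrary: x and x rule: tt_tt_bag.inducts)
  case (tt_Lam \<sigma> n G M \<tau>)
  from tt_Lam.IH[of "Suc x"] show ?case by (simp add: count_unbind)
next
  case (tt_ESub \<sigma> k G M \<tau> D B)
  from tt_ESub.IH(1)[of "Suc x"] tt_ESub.IH(2)[of x] show ?case by (simp add: count_unbind)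
qed auto

lemma tt_bag_remove:
  assumes "tt_bag D B \<sigma>" "N \<in># B"
  shows "\<exists>D1 D2. D = D1 + D2 \<and> tt D1 N \<sigma> \<and> tt_bag D2 (B - {#N#}) \<sigma>"
proof -
  \<comment> \<open>The trivial conjunct only gives the mutual induction rule a goal for
    terms.\<close>
  have "tt D N \<tau> \<Longrightarrow> True"
    and "tt_bag D B \<sigma> \<Longrightarrow> \<forall>N\<in>#B. \<exists>D1 D2. D = D1 + D2 \<and> tt D1 N \<sigma> \<and> tt_bag D2 (B - {#N#}) \<sigma>"
    for D N \<tau> B \<sigma>
  proof (induction rule: tt_tt_bag.inducts)
    case (tt_add G M \<sigma> D B)
    show ?case
    proof
      fix N assume "N \<in># add_mset M B"
      show "\<exists>D1 D2. G + D = D1 + D2 \<and> tt D1 N \<sigma> \<and> tt_bag D2 (add_mset M B - {#N#}) \<sigma>"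
      proof (cases "N = M")
        case True
        with tt_add.hyps show ?thesis by auto
      next
        case False
        with \<open>N \<in># add_mset M B\<close> tt_add.IH obtain D1 D2 where D: "D = D1 + D2"
          and N: "tt D1 N \<sigma>" and B: "tt_bag D2 (B - {#N#}) \<sigma>"
          by (auto simp del: plus_fun_apply)
        from tt_tt_bag.tt_add[OF tt_add.hyps(1) B]
        have "tt_bag (G + D2) (add_mset M B - {#N#}) \<sigma>" using False by simp
        moreover have "G + D = D1 + (G + D2)" by (simp add: D add_ac)
        ultimately show ?thesis using N by blast
      qed
    qed
  qed auto
  with assms show ?thesis by blast
qed


section \<open>Lifting and linear head substitution\<close>

text \<open>The counterpart of \<open>lift_at\<close> on contexts: the index skipped by lifting gets
  the empty type.\<close>

definition insert_omega :: "nat \<Rightarrow> tctx \<Rightarrow> tctx" where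
  "insert_omega k G = (\<lambda>x. if x < k then G x else if x = k then {#} else G (x - 1))"

lemma insert_omega_0: "insert_omega 0 G = case_nat {#} G"
  by (auto simp: insert_omega_def fun_eq_iff split: nat.split)

lemma insert_omega_zero: "insert_omega k 0 = 0"
  by (auto simp: insert_omega_def fun_eq_iff)

lemma insert_omega_plus: "insert_omega k (G + D) = insert_omega k G + insert_omega k D"
  by (auto simp: insert_omega_def fun_eq_iff)

lemma insert_omega_case_nat: "insert_omega (Suc k) (case_nat \<pi> G) = case_nat \<pi> (insert_omega k G)"
  by (auto simp: insert_omega_def fun_eq_iff split: nat.split)

lemma insert_omega_single: "insert_omega k (single x \<sigma>) = single (if x < k then x else Suc x) \<sigma>"
  by (auto simp: insert_omega_def fun_eq_iff)

lemma count_lift: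
  "count (image_mset (\<lambda>x. if x < k then x else Suc x) X) y =
    (if y < k then count X y else if y = k then 0 else count X (y - 1))"
  by (induction X) auto

lemma tt_lift_at:
  "tt G M \<tau> \<Longrightarrow> tt (insert_omega k G) (lift_at M k) \<tau>"
  "tt_bag D B \<sigma> \<Longrightarrow> tt_bag (insert_omega k D) (image_mset (\<lambda>N. lift_at N k) B) \<sigma>"
proof (induction arbitrary: k and k rule: tt_tt_bag.inducts)
  case (tt_Var x \<sigma>)
  show ?case using tt_tt_bag.tt_Var by (simp add: insert_omega_single)
next
  case (tt_Lam \<sigma> n G M \<tau>)
  from tt_Lam.IH[of "Suc k"] show ?case
    by (auto simp: insert_omega_case_nat intro: tt_tt_bag.tt_Lam)
next
  case (tt_App G M \<sigma> j \<tau> D B)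
  then show ?case by (auto simp: insert_omega_plus intro: tt_tt_bag.tt_App simp del: plus_fun_apply)
next
  case (tt_ESub \<sigma> k' G M \<tau> D B)
  from tt_ESub.IH(1)[of "Suc k"] tt_ESub.IH(2)[of k] show ?case
    by (auto simp: insert_omega_case_nat insert_omega_plus intro: tt_tt_bag.tt_ESub
        simp del: plus_fun_apply)
next
  case (tt_Fail G X \<tau>)
  then show ?case by (auto simp: count_lift insert_omega_def intro!: tt_tt_bag.tt_Fail)
next
  case (tt_empty \<sigma>)
  then show ?case by (auto simp: insert_omega_zero intro: tt_tt_bag.tt_empty
        simp del: zero_fun_apply)
next
  case (tt_add G M \<sigma> D B)
  then show ?case by (auto simp: insert_omega_plus intro: tt_tt_bag.tt_add simp del: plus_fun_apply)
qed

lemma tt_lift: "tt G M \<tau> \<Longrightarrow> tt (case_nat {#} G) (lift M) \<tau>"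
  using tt_lift_at(1)[of G M \<tau> 0] by (simp add: insert_omega_0)

text \<open>The last clause is only an implication, since the head of an explicit substitution with
  mismatched sizes is a failure.\<close>

lemma head_var_simps:
  "head_var (Var y) x \<longleftrightarrow> y = x"
  "head_var (App M B) x \<longleftrightarrow> head_var M x"
  "\<not> head_var (Lam M) x"
  "\<not> head_var (Fail X) x"
  "head_var (ESub M B) x \<Longrightarrow> head_var M (Suc x)"
  by (auto simp: head_var_def split: if_splits prod.splits)

text \<open>Induction along the path to the head, where the variable axiom uses up one type of
  \<open>x\<close>. As all types of \<open>x\<close> equal \<sigma>, this is the type of
  \<open>N\<close>, whatever other occurrences of \<open>x\<close> remain.\<close>

lemma tt_lhsubst:
  assumes "tt G M \<tau>" "head_var M x" "tt D N \<sigma>" "\<And>t. t \<in># G x \<Longrightarrow> t = \<sigma>"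
  shows "\<exists>G'. G = G' + single x \<sigma> \<and> tt (G' + D) (lhsubst M N x) \<tau>"
  using assms
proof (induction M arbitrary: G \<tau> x D N)
  case (Var y)
  from \<open>tt G (Var y) \<tau>\<close> have "G = single y \<tau>" by (auto elim: tt_VarE)
  with Var.prems have "G = 0 + single x \<sigma>" "y = x" "\<tau> = \<sigma>" by (auto simp: head_var_simps fun_eq_iff)
  with \<open>tt D N \<sigma>\<close> show ?case by (intro exI[of _ 0]) simp
next
  case (App M B)
  from \<open>tt G (App M B) \<tau>\<close> obtain G1 G2 \<rho> j where G: "G = G1 + G2"
    and M: "tt G1 M (Arrow (power_ty \<rho> j) \<tau>)" and B: "tt_bag G2 B \<rho>"
    by (auto elim: tt_AppE)
  from App.prems G have "head_var M x" "\<And>t. t \<in># G1 x \<Longrightarrow> t = \<sigma>" by (auto simp: head_var_simps)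
  from App.IH(1)[OF M this(1) \<open>tt D N \<sigma>\<close> this(2)]
  obtain G' where G': "G1 = G' + single x \<sigma>"
    and M': "tt (G' + D) (lhsubst M N x) (Arrow (power_ty \<rho> j) \<tau>)"
    by blast
  from tt_App[OF M' B] have "tt (G' + G2 + D) (lhsubst (App M B) N x) \<tau>" by (simp add: add_ac)
  moreover have "G = G' + G2 + single x \<sigma>" by (simp add: G G' add_ac)
  ultimately show ?case by blast
next
  case (ESub M B)
  from \<open>tt G (ESub M B) \<tau>\<close> obtain G1 G2 \<rho> k where G: "G = G1 + G2"
    and M: "tt (case_nat (power_ty \<rho> k) G1) M \<tau>" and B: "tt_bag G2 B \<rho>"
    by (auto elim: tt_ESubE)
  from ESub.prems G have "head_var M (Suc x)"
    "\<And>t. t \<in># case_nat (power_ty \<rho> k) G1 (Suc x) \<Longrightarrow> t = \<sigma>"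
    by (auto simp: head_var_simps)
  from ESub.IH(1)[OF M this(1) tt_lift[OF \<open>tt D N \<sigma>\<close>] this(2)]
  obtain H where H: "case_nat (power_ty \<rho> k) G1 = H + single (Suc x) \<sigma>"
    and M': "tt (H + case_nat {#} D) (lhsubst M (lift N) (Suc x)) \<tau>"
    by blast
  \<comment> \<open>The type removed belongs to \<open>Suc x\<close>, so the entry of
    \<open>H\<close> for the bound index 0 is intact and can be peeled off.\<close>
  define G' where "G' = (\<lambda>y. H (Suc y))"
  have "H 0 = power_ty \<rho> k" using fun_cong[OF H, of 0] by simp
  then have H': "H = case_nat (power_ty \<rho> k) G'"
    by (auto simp: G'_def fun_eq_iff split: nat.split)
  have "G1 y = (G' + single x \<sigma>) y" for y using fun_cong[OF H, of "Suc y"] by (simp add: G'_def)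
  then have G1: "G1 = G' + single x \<sigma>" by blast
  from M' have "tt (case_nat (power_ty \<rho> k) (G' + D)) (lhsubst M (lift N) (Suc x)) \<tau>"
    by (simp add: H' case_nat_plus)
  from tt_ESub[OF this B] have "tt (G' + G2 + D) (lhsubst (ESub M B) N x) \<tau>" by (simp add: add_ac)
  moreover have "G = G' + G2 + single x \<sigma>" by (simp add: G G1 add_ac)
  ultimately show ?case by blast
qed (auto simp: head_var_simps)


section \<open>Subject reduction for total contexts\<close>

text \<open>Serves all three failure rules: each decorates its result with exactly the free
  variables of the redex.\<close>

lemma tt_Fail_mfv: "tt G M \<tau> \<Longrightarrow> mfv M = X \<Longrightarrow> tt G (Fail X) \<tau>"
  by (auto simp: size_tctx intro: tt_Fail)

text \<open>The multiplicity of the bound variable drops by one, while the context of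
  \<open>N\<close> moves from the bag to the body; the total context is unchanged.\<close>

lemma tt_fetch:
  assumes "tt G (ESub M B) \<tau>" "head_var M 0" "N \<in># B"
  shows "tt G (ESub (lhsubst M (lift N) 0) (B - {#N#})) \<tau>"
proof -
  from assms(1) obtain G1 D \<sigma> k where G: "G = G1 + D"
    and M: "tt (case_nat (power_ty \<sigma> k) G1) M \<tau>" and B: "tt_bag D B \<sigma>"
    by (auto elim: tt_ESubE)
  from tt_bag_remove[OF B \<open>N \<in># B\<close>] obtain D1 D2 where D: "D = D1 + D2"
    and N: "tt D1 N \<sigma>" and B': "tt_bag D2 (B - {#N#}) \<sigma>"
    by blast
  have "t = \<sigma>" if "t \<in># case_nat (power_ty \<sigma> k) G1 0" for t
    using that by (auto split: if_splits)
  from tt_lhsubst[OF M assms(2) tt_lift[OF N] this]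
  obtain H where H: "case_nat (power_ty \<sigma> k) G1 = H + single 0 \<sigma>"
    and M': "tt (H + case_nat {#} D1) (lhsubst M (lift N) 0) \<tau>"
    by blast
  \<comment> \<open>This equation excludes \<open>k = 0\<close>, so \<open>k - 1\<close> below is a
    genuine predecessor.\<close>
  have "power_ty \<sigma> k = add_mset \<sigma> (H 0)" using fun_cong[OF H, of 0] by simp
  then have "H 0 = power_ty \<sigma> (k - 1)" by (cases k) auto
  moreover have "H (Suc y) = G1 y" for y using fun_cong[OF H, of "Suc y"] by simp
  ultimately have "H = case_nat (power_ty \<sigma> (k - 1)) G1"
    by (auto simp: fun_eq_iff split: nat.split)
  with M' have "tt (case_nat (power_ty \<sigma> (k - 1)) (G1 + D1)) (lhsubst M (lift N) 0) \<tau>"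
    by (simp add: case_nat_plus)
  from tt_ESub[OF this B'] show ?thesis by (simp add: G D add_ac)
qed

text \<open>The identity is always a permutation, so the sum has a summand even for the empty
  bag.\<close>

lemma set_mset_sum_PER: "set_mset (sum_PER B M) = {M}"
proof -
  have "{p. p permutes {..<size B}} \<noteq> {}" using permutes_id by blast
  then show ?thesis by (simp add: sum_PER_def finite_permutations image_constant_conv)
qed

text \<open>Required because an empty sum is never well-formed, even though all its summands
  vacuously are.\<close>

lemma tred_nonempty: "tred M E \<Longrightarrow> E \<noteq> {#}"
proof (induction rule: tred.induct)
  case (R_Fail M B)
  then show ?case by (metis insert_not_empty set_mset_empty set_mset_sum_PER)
next
  case (R_Cons1 X B)
  then show ?case by (metis insert_not_empty set_mset_empty set_mset_sum_PER)
next
  case (R_Cons2 X B)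
  then show ?case by (metis insert_not_empty set_mset_empty set_mset_sum_PER)
qed auto

lemma tt_tred: "tred M E \<Longrightarrow> tt G M \<tau> \<Longrightarrow> M' \<in># E \<Longrightarrow> tt G M' \<tau>"
proof (induction arbitrary: G \<tau> M' rule: tred.induct)
  case (R_Beta M B)
  \<comment> \<open>The two inversions may yield different strict types if the argument type is
    \<omega>. Only the multiset types are identified, and \<sigma> is the one from the application,
    which fits the bag.\<close>
  from \<open>tt G (App (Lam M) B) \<tau>\<close> obtain G1 D \<sigma> j where G: "G = G1 + D"
    and M: "tt (case_nat (power_ty \<sigma> j) G1) M \<tau>" and B: "tt_bag D B \<sigma>"
    by (elim tt_AppE tt_LamE) (metis sty.inject)
  from tt_ESub[OF M B] show ?case using R_Beta G by (simp del: plus_fun_apply)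
next
  case (R_Fetch M B)
  then show ?case by (auto intro: tt_fetch)
next
  case (R_Fail M B)
  then show ?case by (auto simp: set_mset_sum_PER intro: tt_Fail_mfv)
next
  case (R_Cons1 X B)
  then show ?case by (auto simp: set_mset_sum_PER intro: tt_Fail_mfv)
next
  case (R_Cons2 X B)
  then show ?case by (auto simp: set_mset_sum_PER intro: tt_Fail_mfv)
next
  case (R_TCont_App M E B)
  then show ?case by (auto elim!: tt_AppE intro: tt_App simp del: plus_fun_apply)
next
  case (R_TCont_ESub M E B)
  then show ?case by (auto elim!: tt_ESubE intro: tt_ESub simp del: plus_fun_apply)
qed


section \<open>Partial and total contexts\<close>

definition total_ctx :: "ctx \<Rightarrow> tctx" where
  "total_ctx \<Gamma> x = (case \<Gamma> x of None \<Rightarrow> {#} | Some \<pi> \<Rightarrow> \<pi>)"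

lemma total_empty: "total_ctx Map.empty = 0"
  by (auto simp: total_ctx_def fun_eq_iff)

lemma total_singleton: "total_ctx [x \<mapsto> {#\<sigma>#}] = single x \<sigma>"
  by (auto simp: total_ctx_def fun_eq_iff)

lemma total_weak: "x \<notin> dom \<Gamma> \<Longrightarrow> total_ctx (\<Gamma>(x \<mapsto> {#})) = total_ctx \<Gamma>"
  by (auto simp: total_ctx_def fun_eq_iff split: option.split)

lemma total_conj: "total_ctx (\<Gamma> \<and>\<^sub>c \<Delta>) = total_ctx \<Gamma> + total_ctx \<Delta>"
  by (auto simp: total_ctx_def ctx_conj_def fun_eq_iff split: option.split)

lemma total_ext: "total_ctx (\<pi> \<cdot>\<^sub>c \<Gamma>) = case_nat \<pi> (total_ctx \<Gamma>)"
  by (auto simp: total_ctx_def ctx_ext_def fun_eq_iff split: nat.split)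

lemma dom_ctx_conj: "dom (\<Gamma> \<and>\<^sub>c \<Delta>) = dom \<Gamma> \<union> dom \<Delta>"
  by (auto simp: ctx_conj_def split: option.splits)

lemma dom_ctx_ext: "dom (\<pi> \<cdot>\<^sub>c \<Gamma>) = insert 0 (Suc ` dom \<Gamma>)"
proof (rule set_eqI)
  show "x \<in> dom (\<pi> \<cdot>\<^sub>c \<Gamma>) \<longleftrightarrow> x \<in> insert 0 (Suc ` dom \<Gamma>)" for x
    by (cases x) (auto simp: ctx_ext_def)
qed

lemma finite_dom_ctx_ext: "finite (dom (\<pi> \<cdot>\<^sub>c \<Gamma>)) \<longleftrightarrow> finite (dom \<Gamma>)"
  by (simp add: dom_ctx_ext finite_image_iff)

lemma count_mdom: "finite (dom \<Gamma>) \<Longrightarrow> count (mdom \<Gamma>) x = size (total_ctx \<Gamma> x)"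
  by (auto simp: mdom_def total_ctx_def count_sum sum.delta' split: option.split)

text \<open>All that \<open>total_ctx\<close> forgets is the difference between \<open>None\<close>
  and \<open>Some \<omega>\<close>, which the domain records.\<close>

lemma ctx_eqI: "dom \<Gamma> = dom \<Delta> \<Longrightarrow> total_ctx \<Gamma> = total_ctx \<Delta> \<Longrightarrow> \<Gamma> = \<Delta>"
proof
  fix x assume "dom \<Gamma> = dom \<Delta>" "total_ctx \<Gamma> = total_ctx \<Delta>"
  then have "x \<in> dom \<Gamma> \<longleftrightarrow> x \<in> dom \<Delta>" "total_ctx \<Gamma> x = total_ctx \<Delta> x" by auto
  then show "\<Gamma> x = \<Delta> x" by (auto simp: total_ctx_def split: option.splits)
qed

lemma replicate_mset_eq_cases:
  "replicate_mset m a = replicate_mset n b \<Longrightarrow> m = n \<and> (n = 0 \<or> a = b)"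
  by (metis count_replicate_mset size_replicate_mset)

text \<open>The type of an empty bag does not determine \<open>\<sigma>\<close>, hence the universal quantification.\<close>

definition total_bag :: "ctx \<Rightarrow> bag \<Rightarrow> mty \<Rightarrow> bool" where
  "total_bag \<Gamma> B \<pi> \<longleftrightarrow> finite (dom \<Gamma>) \<and> (\<exists>\<sigma>. \<pi> = power_ty \<sigma> (size B)) \<and>
     (\<forall>\<sigma> k. \<pi> = power_ty \<sigma> k \<longrightarrow> tt_bag (total_ctx \<Gamma>) B \<sigma>)"

lemma total_bag_empty: "total_bag Map.empty {#} {#}"
  by (auto simp: total_bag_def total_empty intro: tt_empty)

lemma total_bag_add:
  assumes "finite (dom \<Gamma>)" "tt (total_ctx \<Gamma>) M \<sigma>" "total_bag \<Delta> B (power_ty \<sigma> k)"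
  shows "total_bag (\<Gamma> \<and>\<^sub>c \<Delta>) (add_mset M B) (power_ty \<sigma> (Suc k))"
proof -
  have "size B = k" using assms(3) by (metis size_replicate_mset total_bag_def)
  \<comment> \<open>With at least one copy the strict type is determined, so the universal
    quantifier in \<open>total_bag\<close> ranges over \<sigma> alone.\<close>
  moreover have "\<sigma>' = \<sigma>" if "power_ty \<sigma> (Suc k) = power_ty \<sigma>' k'" for \<sigma>' k'
    using replicate_mset_eq_cases[OF that] by auto
  moreover have "tt_bag (total_ctx \<Delta>) B \<sigma>" using assms(3) by (auto simp: total_bag_def)
  ultimately show ?thesis
    using assms unfolding total_bag_def
    by (auto simp: dom_ctx_conj total_conj intro!: tt_add exI[of _ \<sigma>]
        simp del: replicate_mset_Suc)
qed

lemma tt_if_wt: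
  "wt \<Gamma> M \<tau> \<Longrightarrow> finite (dom \<Gamma>) \<and> tt (total_ctx \<Gamma>) M \<tau>"
  "wt_bag \<Delta> B \<pi> \<Longrightarrow> total_bag \<Delta> B \<pi>"
proof (induction rule: wt_wt_bag.inducts)
  case (T_app \<Gamma> M \<pi> \<tau> \<Delta> B)
  then show ?case
    \<comment> \<open>The multiset type in \<open>T_app\<close> is arbitrary; the existential part
      of \<open>total_bag\<close> gives it the power form that \<open>tt_App\<close>
      expects.\<close>
    by (auto simp: total_bag_def dom_ctx_conj total_conj intro: tt_App
        simp del: plus_fun_apply)
next
  case (T_ex_sub \<sigma> k \<Gamma> M \<tau> \<Delta> B)
  then show ?case
    by (auto simp: total_bag_def dom_ctx_conj finite_dom_ctx_ext total_conj total_ext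
        intro: tt_ESub simp del: plus_fun_apply)
qed (auto simp: total_singleton total_weak finite_dom_ctx_ext total_ext
    intro: tt_Var tt_Lam total_bag_empty total_bag_add
    simp del: replicate_mset_Suc fun_upd_apply)

lemma tt_if_wf_tm:
  "wf_tm \<Gamma> M \<tau> \<Longrightarrow> finite (dom \<Gamma>) \<and> tt (total_ctx \<Gamma>) M \<tau>"
  "wf_bag \<Delta> B \<pi> \<Longrightarrow> total_bag \<Delta> B \<pi>"
proof (induction rule: wf_tm_wf_bag.inducts)
  case (F_app \<Gamma> M \<sigma> j \<tau> \<Delta> B k)
  then show ?case
    by (auto simp: total_bag_def dom_ctx_conj total_conj intro: tt_App
        simp del: plus_fun_apply)
next
  case (F_ex_sub \<sigma> k \<Gamma> M \<tau> \<Delta> B)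
  then show ?case
    by (auto simp: total_bag_def dom_ctx_conj finite_dom_ctx_ext total_conj total_ext
        intro: tt_ESub simp del: plus_fun_apply)
next
  case (F_fail \<Gamma> X \<tau>)
  then show ?case by (auto simp: count_mdom intro!: tt_Fail)
qed (auto simp: tt_if_wt total_weak finite_dom_ctx_ext total_ext
    intro: tt_Lam total_bag_add simp del: replicate_mset_Suc fun_upd_apply)

section \<open>From total contexts back to partial contexts with a chosen domain\<close>

definition ctx_on :: "nat set \<Rightarrow> tctx \<Rightarrow> ctx" where
  "ctx_on A G = (\<lambda>x. if x \<in> A then Some (G x) else None)"

lemma dom_ctx_on: "dom (ctx_on A G) = A"
  by (auto simp: ctx_on_def split: if_splits)

lemma total_on: "(\<And>x. x \<notin> A \<Longrightarrow> G x = {#}) \<Longrightarrow> total_ctx (ctx_on A G) = G"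
  by (auto simp: ctx_on_def total_ctx_def fun_eq_iff)

abbreviation supp :: "tctx \<Rightarrow> nat set" where
  "supp G \<equiv> {x. G x \<noteq> {#}}"

lemma total_on_supp: "total_ctx (ctx_on (supp G) G) = G"
  by (rule total_on) simp

lemma supp_total: "supp (total_ctx \<Gamma>) \<subseteq> dom \<Gamma>"
  by (auto simp: total_ctx_def split: option.splits)

lemma finite_supp: "tt G M \<tau> \<Longrightarrow> finite (supp G)"
proof -
  assume "tt G M \<tau>"
  \<comment> \<open>By \<open>size_tctx\<close>, a type is nonempty exactly if its variable occurs
    free.\<close>
  then have "supp G = set_mset (mfv M)"
    by (auto simp: size_tctx(1) simp flip: size_eq_0_iff_empty count_greater_zero_iff)
  then show ?thesis by simp
qed

text \<open>\<open>F_weak\<close> adds one variable at a time, hence the induction over a finite set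
  of added variables; equality of the total contexts forces their types to be \<omega>.\<close>

lemma wf_tm_weaken:
  assumes "wf_tm \<Gamma> M \<tau>" "finite (dom \<Delta>)" "dom \<Gamma> \<subseteq> dom \<Delta>" "total_ctx \<Delta> = total_ctx \<Gamma>"
  shows "wf_tm \<Delta> M \<tau>"
proof -
  have "wf_tm (ctx_on (dom \<Gamma> \<union> A) (total_ctx \<Gamma>)) M \<tau>" if "finite A" for A
    using that
  proof (induction A rule: finite_induct)
    case empty
    have "ctx_on (dom \<Gamma>) (total_ctx \<Gamma>) = \<Gamma>"
      using supp_total by (intro ctx_eqI total_on) (auto simp: dom_ctx_on)
    with assms(1) show ?case by simp
  next
    case (insert x A)
    show ?case
    proof (cases "x \<in> dom \<Gamma>")
      case True
      with insert.IH show ?thesis by (simp add: insert_absorb)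
    next
      case False
      then have "total_ctx \<Gamma> x = {#}" using supp_total by blast
      then have "ctx_on (dom \<Gamma> \<union> insert x A) (total_ctx \<Gamma>) =
        (ctx_on (dom \<Gamma> \<union> A) (total_ctx \<Gamma>))(x \<mapsto> {#})"
        by (auto simp: ctx_on_def fun_eq_iff)
      with insert False F_weak[of "ctx_on (dom \<Gamma> \<union> A) (total_ctx \<Gamma>)" M \<tau> x] show ?thesis
        by (simp add: dom_ctx_on del: fun_upd_apply)
    qed
  qed
  from this[OF assms(2)] have "wf_tm (ctx_on (dom \<Delta>) (total_ctx \<Delta>)) M \<tau>"
    using assms(3,4) by (simp add: Un_absorb1)
  moreover have "ctx_on (dom \<Delta>) (total_ctx \<Delta>) = \<Delta>"
    using supp_total by (intro ctx_eqI total_on) (auto simp: dom_ctx_on)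
  ultimately show ?thesis by simp
qed

text \<open>Undoes juxtaposition: the left part keeps the whole domain and so all declarations of
  type \<omega>, the right part only what the bag uses.\<close>

lemma split_ctx:
  assumes "total_ctx \<Gamma> = G + D"
  shows "\<Gamma> = ctx_on (dom \<Gamma>) G \<and>\<^sub>c ctx_on (supp D) D" "total_ctx (ctx_on (dom \<Gamma>) G) = G"
proof -
  have "supp G \<subseteq> dom \<Gamma>" "supp D \<subseteq> dom \<Gamma>"
    using supp_total[of \<Gamma>] by (auto simp: assms)
  then show *: "total_ctx (ctx_on (dom \<Gamma>) G) = G" by (intro total_on) auto
  show "\<Gamma> = ctx_on (dom \<Gamma>) G \<and>\<^sub>c ctx_on (supp D) D"
    using \<open>supp D \<subseteq> dom \<Gamma>\<close>
    by (intro ctx_eqI) (auto simp: dom_ctx_conj dom_ctx_on total_conj * total_on_supp assms)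
qed

text \<open>Bags have no weakening rule, and the empty bag is formed only in the empty context. They
  are therefore given the least domain, whereas a term, which can be weakened, admits any suitable
  finite one.\<close>

lemma wf_tm_if_tt:
  "tt G M \<tau> \<Longrightarrow> finite (dom \<Gamma>) \<Longrightarrow> total_ctx \<Gamma> = G \<Longrightarrow> wf_tm \<Gamma> M \<tau>"
  "tt_bag D B \<sigma> \<Longrightarrow> wf_bag (ctx_on (supp D) D) B (power_ty \<sigma> (size B))"
proof (induction arbitrary: \<Gamma> rule: tt_tt_bag.inducts)
  case (tt_Var x \<sigma>)
  have "x \<in> dom \<Gamma>" using supp_total[of \<Gamma>] by (auto simp: tt_Var split: if_splits)
  with tt_Var show ?case
    by (intro wf_tm_weaken[OF F_wf_tm[OF T_var]]) (auto simp: total_singleton)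
next
  case (tt_Lam \<sigma> n G M \<tau>)
  then show ?case by (auto simp: finite_dom_ctx_ext total_ext intro: F_abs)
next
  case (tt_App G M \<sigma> j \<tau> D B)
  note \<Gamma> = split_ctx[OF tt_App.prems(2)]
  have "wf_tm (ctx_on (dom \<Gamma>) G) M (Arrow (power_ty \<sigma> j) \<tau>)"
    by (rule tt_App.IH) (simp_all add: \<Gamma>(2) dom_ctx_on tt_App.prems)
  from F_app[OF this tt_App.IH(2)] show ?case using \<Gamma>(1) by simp
next
  case (tt_ESub \<sigma> k G M \<tau> D B)
  note \<Gamma> = split_ctx[OF tt_ESub.prems(2)]
  have "wf_tm (power_ty \<sigma> k \<cdot>\<^sub>c ctx_on (dom \<Gamma>) G) M \<tau>"
    by (rule tt_ESub.IH)
      (simp_all add: \<Gamma>(2) finite_dom_ctx_ext total_ext dom_ctx_on tt_ESub.prems)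
  from F_ex_sub[OF this tt_ESub.IH(2)] show ?case using \<Gamma>(1) by simp
next
  case (tt_Fail G X \<tau>)
  then show ?case by (auto simp: multiset_eq_iff count_mdom intro!: F_fail)
next
  case (tt_empty \<sigma>)
  have "ctx_on (supp 0) 0 = Map.empty" by (auto simp: ctx_on_def)
  then show ?case using F_wf_bag[OF T_one] by (simp del: zero_fun_apply)
next
  case (tt_add G M \<sigma> D B)
  have "wf_tm (ctx_on (supp G) G) M \<sigma>"
    by (rule tt_add.IH) (auto simp: dom_ctx_on total_on_supp finite_supp[OF tt_add.hyps(1)])
  \<comment> \<open>Multiset sums never cancel, so the support of the sum is the union of the
    supports.\<close>
  moreover have "ctx_on (supp (G + D)) (G + D) = ctx_on (supp G) G \<and>\<^sub>c ctx_on (supp D) D"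
    by (rule ctx_eqI) (auto simp only: dom_ctx_conj dom_ctx_on total_conj total_on_supp, auto)
  ultimately show ?case using F_bag[OF _ tt_add.IH(2)] by (simp del: plus_fun_apply)
qed

text \<open>The finiteness condition does not mention \<open>M\<close>, so subject reduction carries
  over with the very same \<Gamma>.\<close>

lemma wf_tm_iff_tt: "wf_tm \<Gamma> M \<tau> \<longleftrightarrow> finite (dom \<Gamma>) \<and> tt (total_ctx \<Gamma>) M \<tau>"
  using tt_if_wf_tm(1) wf_tm_if_tt(1) by blast


section \<open>Expressions\<close>

lemma wt_expr_imp_wt: "wt_expr \<Gamma> E \<tau> \<Longrightarrow> E \<noteq> {#} \<and> (\<forall>M\<in>#E. wt \<Gamma> M \<tau>)"
  by (induction rule: wt_expr.induct) auto

lemma wf_expr_imp_wf_tm: "\<Gamma> \<Turnstile> E : \<tau> \<Longrightarrow> E \<noteq> {#} \<and> (\<forall>M\<in>#E. wf_tm \<Gamma> M \<tau>)"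
  by (induction rule: wf_expr.induct) (auto dest: wt_expr_imp_wt intro: F_wf_tm)

lemma wf_expr_if_wf_tm: "E \<noteq> {#} \<Longrightarrow> (\<And>M. M \<in># E \<Longrightarrow> wf_tm \<Gamma> M \<tau>) \<Longrightarrow> \<Gamma> \<Turnstile> E : \<tau>"
proof (induction E)
  case (add M E)
  then have "\<Gamma> \<Turnstile> {#M#} : \<tau>" by (auto intro: F_term)
  show ?case
  \<comment> \<open>\<open>F_sum\<close> needs both parts well-formed, so a single summand has to be
    the base case.\<close>
  proof (cases "E = {#}")
    case False
    with add F_sum[OF \<open>\<Gamma> \<Turnstile> {#M#} : \<tau>\<close>, of E] show ?thesis by simp
  qed (use \<open>\<Gamma> \<Turnstile> {#M#} : \<tau>\<close> in simp)
qed simp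

text \<open>Phrased by summands because \<open>F\<close> in \<open>R_ECont\<close> may be empty and
  thus not well-formed as an expression.\<close>

lemma wf_tm_red:
  "E \<longmapsto> E' \<Longrightarrow> (\<And>M. M \<in># E \<Longrightarrow> wf_tm \<Gamma> M \<tau>) \<Longrightarrow> E' \<noteq> {#} \<and> (\<forall>M\<in>#E'. wf_tm \<Gamma> M \<tau>)"
  by (induction rule: red.induct) (auto simp: wf_tm_iff_tt dest: tred_nonempty tt_tred)

theorem theorem2p25:
  fixes \<Gamma> :: ctx and E E' :: expr and \<tau> :: sty
  assumes "\<Gamma> \<Turnstile> E : \<tau>" and "E \<longmapsto> E'"
  shows "\<Gamma> \<Turnstile> E' : \<tau>"
  using wf_expr_imp_wf_tm[OF assms(1)] wf_tm_red[OF assms(2)] wf_expr_if_wf_tm by metis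

end
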